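(* $\mathrm{int}(\mathbb H_N)$ is a domain (non-empty connected open set) in $\mathbb C^4$ and $\overline{\mathrm{int}(\mathbb H_N)}=\overline{\mathbb H}_N$.
   Context: $\mathrm{int}(\cdot)$ and overlines denote interior and closure in $\mathbb C^4$; $\|\cdot\|$ is the operator norm on $M_2(\mathbb C)$ induced by the Euclidean norm on $\mathbb C^2$. $\pi:M_2(\mathbb C)\to\mathbb C^4$ is $\pi((a_{ij}))=(a_{21},a_{11},a_{22},\det(A))$, and the normed hexablock is $\mathbb H_N=\{\pi(A): A\in M_2(\mathbb C),\ \|A\|<1\}$. *)

theory Defs
  imports "HOL-Analysis.Analysis"
begin

definition op_norm :: "complex^2^2 \<Rightarrow> real" where
  "op_norm A = onorm (\<lambda>v. A *v v)"

(* A $ i $ j is the entry in row i and column j. *)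
definition hexa_pi :: "complex^2^2 \<Rightarrow> complex^4" where
  "hexa_pi A = vector [A $ 2 $ 1, A $ 1 $ 1, A $ 2 $ 2, det A]"

definition normed_hexablock :: "(complex^4) set" where
  "normed_hexablock = {hexa_pi A | A. op_norm A < 1}"

end

theory Submission
  imports Defs
begin

text \<open>
  The first coordinate of \<^term>\<open>hexa_pi A\<close> is the lower left entry of \<open>A\<close>.  Where it is non-zero,
  the determinant determines the upper right entry, so \<^const>\<open>hexa_pi\<close> is injective there with a
  continuous inverse, and the part of the hexablock off the hyperplane \<open>x\<^sub>1 = 0\<close> is open.  On
  that hyperplane the matrix is triangular, so points of the hexablock satisfy \<open>x\<^sub>4 = x\<^sub>2 x\<^sub>3\<close> and
  no neighbourhood of them lies in the hexablock.  Hence the interior consists exactly of the points with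
  \<open>x\<^sub>1 \<noteq> 0\<close> (\<open>interior_normed_hexablock\<close>), and it is the continuous image of the open unit ball of
  matrices with a complex hyperplane removed.  Removing a complex hyperplane leaves the ball connected,
  because two points off the hyperplane span a complex line which meets it in at most one point
  (\<open>connected_contractions_lower_left_nonzero\<close>), and leaves it dense in the ball
  (\<open>contractions_subset_closure\<close>); both properties pass to the image.
\<close>

lemma norm_axis: "norm (axis i x :: 'a::real_inner ^ 'n) = norm x"
  by (simp add: norm_eq_sqrt_inner inner_axis_axis)

section \<open>The operator-norm unit ball\<close>

text \<open>Identifying matrices with bounded operators, a linear identification in finite dimension, makes
  the unit ball the preimage of a ball in a normed space, hence open and convex.\<close>

lemma contractions_vimage_ball:
  obtains F :: "complex^2^2 \<Rightarrow> (complex^2) \<Rightarrow>\<^sub>L (complex^2)"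
    where "bounded_linear F" "{A. op_norm A < 1} = F -` ball 0 1"
proof
  let ?F = "\<lambda>A::complex^2^2. Blinfun (\<lambda>v. A *v v)"
  have app: "blinfun_apply (?F A) = (\<lambda>v. A *v v)" for A
    by (rule bounded_linear_Blinfun_apply) simp
  have "linear ?F"
  proof (rule linearI; rule blinfun_eqI)
    fix A B :: "complex^2^2" and r :: real and v :: "complex^2"
    show "?F (A + B) v = (?F A + ?F B) v"
      by (simp only: app plus_blinfun.rep_eq) (rule matrix_vector_mult_add_rdistrib)
    show "?F (r *\<^sub>R A) v = (r *\<^sub>R ?F A) v"
      by (simp only: app scaleR_blinfun.rep_eq)
        (simp add: vec_eq_iff matrix_vector_mult_def scaleR_sum_right)
  qed
  then show "bounded_linear ?F"
    by (simp add: linear_conv_bounded_linear)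
  have "op_norm A = norm (?F A)" for A
    by (simp add: op_norm_def norm_blinfun.rep_eq app)
  then show "{A. op_norm A < 1} = ?F -` ball 0 1"
    by auto
qed

lemma open_contractions: "open {A. op_norm A < 1}"
proof -
  obtain F :: "complex^2^2 \<Rightarrow> (complex^2) \<Rightarrow>\<^sub>L (complex^2)"
    where F: "bounded_linear F" "{A. op_norm A < 1} = F -` ball 0 1"
    by (fact contractions_vimage_ball)
  then show ?thesis
    by (simp add: open_vimage linear_continuous_on)
qed

lemma convex_contractions: "convex {A. op_norm A < 1}"
proof -
  obtain F :: "complex^2^2 \<Rightarrow> (complex^2) \<Rightarrow>\<^sub>L (complex^2)"
    where F: "bounded_linear F" "{A. op_norm A < 1} = F -` ball 0 1"
    by (fact contractions_vimage_ball)
  then show ?thesis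
    by (simp add: convex_linear_vimage bounded_linear.linear)
qed

lemma zero_contraction: "op_norm 0 < 1"
  by (simp add: op_norm_def onorm_zero)

text \<open>Perturbing the lower left entry moves off the hyperplane.\<close>

lemma contractions_subset_closure:
  "{A. op_norm A < 1} \<subseteq> closure {A. op_norm A < 1 \<and> A $ 2 $ 1 \<noteq> 0}"
proof
  fix A :: "complex^2^2" assume A: "A \<in> {A. op_norm A < 1}"
  show "A \<in> closure {A. op_norm A < 1 \<and> A $ 2 $ 1 \<noteq> 0}"
  proof (cases "A $ 2 $ 1 = 0")
    case False
    with A show ?thesis
      by (intro subsetD[OF closure_subset]) simp
  next
    case True
    obtain d where d: "d > 0" "ball A d \<subseteq> {A. op_norm A < 1}"
      using open_contractions A unfolding open_contains_ball by blast
    have "\<exists>B\<in>{A. op_norm A < 1 \<and> A $ 2 $ 1 \<noteq> 0}. dist B A < e" if "e > 0" for e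
    proof
      define r where "r = min d e / 2"
      let ?B = "A + axis 2 (axis 1 (complex_of_real r))"
      have r: "0 < r" "r < d" "r < e"
        using d(1) that by (auto simp: r_def)
      then have dist: "dist ?B A = r"
        by (simp add: dist_norm norm_axis)
      then have "?B \<in> ball A d"
        using r by (simp add: dist_commute)
      then have "op_norm ?B < 1"
        using d(2) by blast
      then show "?B \<in> {A. op_norm A < 1 \<and> A $ 2 $ 1 \<noteq> 0}"
        using r True by (simp add: axis_def)
      show "dist ?B A < e"
        using dist r by simp
    qed
    then show ?thesis
      by (simp add: closure_approachable)
  qed
qed

text \<open>The parameters at which the complex line through two points off the hyperplane runs inside the ball form a convex open
  subset of the plane; removing the one parameter at which the line may meet the hyperplane keeps it
  connected.\<close>

lemma connected_contractions_lower_left_nonzero: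
  "connected {A. op_norm A < 1 \<and> A $ 2 $ 1 \<noteq> 0}" (is "connected ?V")
  unfolding connected_iff_connected_component
proof (intro ballI)
  fix A B assume A: "A \<in> ?V" and B: "B \<in> ?V"
  define L :: "complex \<Rightarrow> complex^2^2"
    where "L z = A + (\<chi> i j. z * (B $ i $ j - A $ i $ j))" for z
  define a b where "a = A $ 2 $ 1" and "b = B $ 2 $ 1"
  \<comment> \<open>For \<open>a = b\<close> the line misses the hyperplane; then any parameter other than those of the two
    points, \<open>0\<close> and \<open>1\<close>, may be removed.\<close>
  define c where "c = (if a = b then 2 else a / (a - b))"
  have "a \<noteq> 0" "b \<noteq> 0"
    using A B by (simp_all add: a_def b_def)
  then have c: "c \<noteq> 0" "c \<noteq> 1"
    by (auto simp: c_def divide_eq_1_iff)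
  let ?M = "\<lambda>z::complex. (\<chi> i j. z * (B $ i $ j - A $ i $ j)) :: complex^2^2"
  have lin: "linear ?M"
    by (rule linearI) (simp_all add: vec_eq_iff algebra_simps)
  have contL: "continuous_on X L" for X
    unfolding L_def
    by (intro continuous_on_add continuous_on_const continuous_on_vec_lambda continuous_intros)
  define S where "S = L -` {A. op_norm A < 1}"
  have "open S"
    unfolding S_def by (intro open_vimage open_contractions contL)
  have "S = ?M -` ((\<lambda>C. - A + C) ` {A. op_norm A < 1})"
    unfolding S_def L_def by (force simp: image_iff)
  then have "convex S"
    using lin convex_contractions by (simp add: convex_linear_vimage convex_translation)
  then have "connected (S - {c})"
    using \<open>open S\<close> by (intro connected_open_delete convex_connected) simp_all
  then have "connected (L ` (S - {c}))"
    by (intro connected_continuous_image contL)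
  moreover have "L ` (S - {c}) \<subseteq> ?V"
  proof clarify
    fix z assume z: "z \<in> S" "z \<noteq> c"
    have "a + z * (b - a) \<noteq> 0"
    proof
      assume "a + z * (b - a) = 0"
      then have "z * (a - b) = a" by algebra
      with \<open>a \<noteq> 0\<close> have "z = c" by (auto simp: c_def eq_divide_eq)
      with z(2) show False by simp
    qed
    then show "op_norm (L z) < 1 \<and> L z $ 2 $ 1 \<noteq> 0"
      using z(1) by (simp add: S_def L_def a_def b_def)
  qed
  moreover have "A \<in> L ` (S - {c})"
  proof
    show "A = L 0" by (simp add: L_def vec_eq_iff)
    then show "0 \<in> S - {c}"
      using A c by (auto simp: S_def)
  qed
  moreover have "B \<in> L ` (S - {c})"
  proof
    show "B = L 1" by (simp add: L_def vec_eq_iff)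
    then show "1 \<in> S - {c}"
      using B c by (auto simp: S_def)
  qed
  ultimately show "connected_component ?V A B"
    unfolding connected_component_def by blast
qed

section \<open>The map from matrices to the hexablock\<close>

lemma hexa_pi_nth [simp]:
  "hexa_pi A $ 1 = A $ 2 $ 1" "hexa_pi A $ 2 = A $ 1 $ 1"
  "hexa_pi A $ 3 = A $ 2 $ 2" "hexa_pi A $ 4 = det A"
  unfolding hexa_pi_def vector_def by simp_all

lemma continuous_on_hexa_pi: "continuous_on S hexa_pi"
proof -
  have "\<forall>i. continuous_on S (\<lambda>A. hexa_pi A $ i)"
    by (simp add: forall_4 det_2) (intro conjI continuous_intros)
  then have "continuous_on S (\<lambda>A. \<chi> i. hexa_pi A $ i)"
    by (intro continuous_on_vec_lambda) blast
  then show ?thesis by simp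
qed

definition hexa_inverse :: "complex^4 \<Rightarrow> complex^2^2" where
  "hexa_inverse x = vector [vector [x $ 2, (x $ 2 * x $ 3 - x $ 4) / x $ 1], vector [x $ 1, x $ 3]]"

lemma hexa_inverse_nth [simp]:
  "hexa_inverse x $ 1 $ 1 = x $ 2" "hexa_inverse x $ 1 $ 2 = (x $ 2 * x $ 3 - x $ 4) / x $ 1"
  "hexa_inverse x $ 2 $ 1 = x $ 1" "hexa_inverse x $ 2 $ 2 = x $ 3"
  by (simp_all add: hexa_inverse_def)

lemma hexa_pi_hexa_inverse: "x $ 1 \<noteq> 0 \<Longrightarrow> hexa_pi (hexa_inverse x) = x"
  by (simp add: vec_eq_iff forall_4 det_2)

lemma hexa_inverse_hexa_pi: "A $ 2 $ 1 \<noteq> 0 \<Longrightarrow> hexa_inverse (hexa_pi A) = A"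
  by (simp add: vec_eq_iff forall_2 det_2)

lemma continuous_on_hexa_inverse: "continuous_on {x. x $ 1 \<noteq> 0} hexa_inverse"
proof -
  have "\<forall>i j. continuous_on {x. x $ 1 \<noteq> 0} (\<lambda>x. hexa_inverse x $ i $ j)"
    by (simp add: forall_2) (intro conjI continuous_intros; simp)
  then have "continuous_on {x. x $ 1 \<noteq> 0} (\<lambda>x. \<chi> i j. hexa_inverse x $ i $ j)"
    by (intro continuous_on_vec_lambda) blast
  then show ?thesis by simp
qed

section \<open>The interior of the hexablock\<close>

lemma normed_hexablock_nonzero_conv_image:
  "{x \<in> normed_hexablock. x $ 1 \<noteq> 0} = hexa_pi ` {A. op_norm A < 1 \<and> A $ 2 $ 1 \<noteq> 0}"
  by (auto simp: normed_hexablock_def)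

lemma open_normed_hexablock_nonzero: "open {x \<in> normed_hexablock. x $ 1 \<noteq> 0}"
proof -
  have "{x \<in> normed_hexablock. x $ 1 \<noteq> 0} = {x. x $ 1 \<noteq> 0} \<inter> hexa_inverse -` {A. op_norm A < 1}"
    by (auto simp: normed_hexablock_def hexa_inverse_hexa_pi)
      (metis hexa_pi_hexa_inverse)
  moreover have "open {x::complex^4. x $ 1 \<noteq> 0}"
    by (intro open_Collect_neq continuous_intros)
  ultimately show ?thesis
    using continuous_open_preimage[OF continuous_on_hexa_inverse _ open_contractions] by simp
qed

lemma normed_hexablock_zero_imp_degenerate:
  "x \<in> normed_hexablock \<Longrightarrow> x $ 1 = 0 \<Longrightarrow> x $ 4 = x $ 2 * x $ 3"
  by (auto simp: normed_hexablock_def det_2)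

text \<open>A point with vanishing first coordinate leaves the hexablock when only its last coordinate, the
  determinant, is changed.\<close>

lemma interior_normed_hexablock:
  "interior normed_hexablock = {x \<in> normed_hexablock. x $ 1 \<noteq> 0}"
proof
  show "{x \<in> normed_hexablock. x $ 1 \<noteq> 0} \<subseteq> interior normed_hexablock"
    using open_normed_hexablock_nonzero by (intro interior_maximal) auto
  show "interior normed_hexablock \<subseteq> {x \<in> normed_hexablock. x $ 1 \<noteq> 0}"
  proof
    fix x assume x: "x \<in> interior normed_hexablock"
    then obtain e where e: "e > 0" "cball x e \<subseteq> normed_hexablock"
      by (auto simp: mem_interior_cball)
    let ?y = "x + axis 4 (complex_of_real e)"
    have "?y \<in> normed_hexablock" "x \<in> normed_hexablock"
      using e by (auto simp: dist_norm norm_axis)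
    then have "x $ 1 \<noteq> 0"
      using e(1) normed_hexablock_zero_imp_degenerate[of x] normed_hexablock_zero_imp_degenerate[of ?y]
      by (auto simp: axis_def)
    with \<open>x \<in> normed_hexablock\<close> show "x \<in> {x \<in> normed_hexablock. x $ 1 \<noteq> 0}"
      by simp
  qed
qed

lemma normed_hexablock_subset_closure_interior:
  "normed_hexablock \<subseteq> closure (interior normed_hexablock)"
proof -
  let ?V = "{A. op_norm A < 1 \<and> A $ 2 $ 1 \<noteq> 0}"
  have "normed_hexablock \<subseteq> hexa_pi ` closure ?V"
    using contractions_subset_closure by (auto simp: normed_hexablock_def)
  also have "\<dots> \<subseteq> closure (hexa_pi ` ?V)"
    by (intro image_closure_subset continuous_on_hexa_pi closed_closure closure_subset)
  finally show ?thesis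
    by (simp add: interior_normed_hexablock normed_hexablock_nonzero_conv_image)
qed

theorem proposition5p16:
  shows "interior normed_hexablock \<noteq> {} \<and>
         connected (interior normed_hexablock) \<and>
         open (interior normed_hexablock) \<and>
         closure (interior normed_hexablock) = closure normed_hexablock"
proof (intro conjI)
  have "normed_hexablock \<noteq> {}"
    using zero_contraction by (auto simp: normed_hexablock_def)
  then show "interior normed_hexablock \<noteq> {}"
    using normed_hexablock_subset_closure_interior by force
  show "connected (interior normed_hexablock)"
    unfolding interior_normed_hexablock normed_hexablock_nonzero_conv_image
    by (intro connected_continuous_image continuous_on_hexa_pi connected_contractions_lower_left_nonzero)
  show "open (interior normed_hexablock)"
    by simp
  show "closure (interior normed_hexablock) = closure normed_hexablock"
    using normed_hexablock_subset_closure_interior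
    by (intro antisym closure_mono interior_subset closure_minimal closed_closure)
qed

end
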